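(* Let $P=(Q,\Sigma)$ be a carefully synchronizing PFA with $|Q| = n$, $|\Sigma| = m$, and shortest carefully synchronizing word length $f(n)$. Assume $s\in\Sigma$ and $Q'\subseteq Q$ satisfy the following properties: (1) $s$ is a complete symbol (that is, $qs$ is defined for all $q\in Q$) and there is some number $p$ such that all symbols of $\Sigma$ are defined on $Qs^p = \{q s^p \mid q\in Q\}$; (2) $qs = q$ for all $q \in Q'$; (3) $qa = qb$ for all $q\in Q'$ and all $a,b\in\Sigma\setminus\{s\}$. Let $n' = n - |Q'|$. Then there exists a carefully synchronizing PFA on $n + n'\cdot(m-2)$ states and $2$ symbols, with shortest carefully synchronizing word length at least $f(n)$.
   Context: A partial finite automaton (PFA) over a finite alphabet $\Sigma$ consists of a finite set $Q$ of states and a partial map $\delta : Q\times\Sigma \to Q$; $\delta(q,a)$ is written $qa$. For $q\in Q$, $w\in\Sigma^*$, $a\in\Sigma$ define $q\lambda = q$ for the empty word $\lambda$, and $q(wa) = \delta(qw,a)$, which is defined only if $qw$ is defined and $\delta(qw,a)$ is defined. A word $w\in\Sigma^*$ is carefully synchronizing if there is a state $q_s\in Q$ such that $qw$ is defined and $qw = q_s$ for all $q \in Q$. A PFA is carefully synchronizing if it admits a carefully synchronizing word; its shortest carefully synchronizing word length is the minimal length of such a word. *)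

theory Defs
  imports Main
begin

record ('q, 'a) pfa =
  states :: "'q set"
  alphabet :: "'a set"
  delta :: "'q \<Rightarrow> 'a \<Rightarrow> 'q option"

text \<open>The value of \<open>delta\<close> at arguments outside \<open>states\<close> and \<open>alphabet\<close> is unconstrained
  and irrelevant.\<close>

definition is_pfa :: "('q, 'a) pfa \<Rightarrow> bool" where
  "is_pfa P \<longleftrightarrow> finite (states P) \<and> finite (alphabet P) \<and>
     (\<forall>q\<in>states P. \<forall>a\<in>alphabet P. \<forall>r. delta P q a = Some r \<longrightarrow> r \<in> states P)"

definition run :: "('q, 'a) pfa \<Rightarrow> 'q \<Rightarrow> 'a list \<Rightarrow> 'q option" where
  "run P q w = foldl (\<lambda>x a. Option.bind x (\<lambda>r. delta P r a)) (Some q) w"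

lemma run_Nil [simp]: "run P q [] = Some q"
  by (simp add: run_def)

lemma run_snoc [simp]: "run P q (w @ [a]) = Option.bind (run P q w) (\<lambda>r. delta P r a)"
  by (simp add: run_def)

definition image_word :: "('q, 'a) pfa \<Rightarrow> 'a list \<Rightarrow> 'q set" where
  "image_word P w = {r. \<exists>q\<in>states P. run P q w = Some r}"

definition defined_on :: "('q, 'a) pfa \<Rightarrow> 'a \<Rightarrow> 'q set \<Rightarrow> bool" where
  "defined_on P a S \<longleftrightarrow> (\<forall>q\<in>S. delta P q a \<noteq> None)"

definition complete_symbol :: "('q, 'a) pfa \<Rightarrow> 'a \<Rightarrow> bool" where
  "complete_symbol P a \<longleftrightarrow> defined_on P a (states P)"

definition carefully_synchronizing_word :: "('q, 'a) pfa \<Rightarrow> 'a list \<Rightarrow> bool" where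
  "carefully_synchronizing_word P w \<longleftrightarrow>
     w \<in> lists (alphabet P) \<and> (\<exists>q\<^sub>s\<in>states P. \<forall>q\<in>states P. run P q w = Some q\<^sub>s)"

definition carefully_synchronizing :: "('q, 'a) pfa \<Rightarrow> bool" where
  "carefully_synchronizing P \<longleftrightarrow> (\<exists>w. carefully_synchronizing_word P w)"

text \<open>Only meaningful for carefully synchronizing automata.\<close>

definition shortest_length :: "('q, 'a) pfa \<Rightarrow> nat" where
  "shortest_length P = (LEAST k. \<exists>w. carefully_synchronizing_word P w \<and> length w = k)"

end

theory Submission
  imports Defs
begin

text \<open>
  Enumerate the symbols other than \<open>s\<close> as \<open>a 0, \<dots>, a (k - 1)\<close>. The binary automaton keeps, next
  to a state \<open>q\<close> of \<open>P\<close>, a counter \<open>i < k\<close> saying which of these symbols is selected. Its letter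
  \<open>0\<close> increments the counter, and when the counter overflows it applies \<open>s\<close> and resets the counter;
  its letter \<open>1\<close> applies the selected symbol \<open>a i\<close> and resets the counter. States in \<open>Q'\<close> need no
  counter: all \<open>a i\<close> agree on them and \<open>s\<close> fixes them, so a single copy behaves like any counter
  value. This leaves \<open>card Q' + n' * k\<close> states, which is the required number for \<open>k = m - 1\<close>.

  The lower bound (\<open>synchronizing_word_down\<close>) follows by watching only the states with counter
  \<open>0\<close>. They all see the same letters, so outside \<open>Q'\<close> they always have a common counter value,
  and every binary word acts on their \<open>P\<close>-components as some word of \<open>P\<close> that is not longer. If
  the binary word merges all states, this word of \<open>P\<close> merges all states of \<open>P\<close>.

  Conversely, \<open>0\<^sup>k\<close> simulates \<open>s\<close> and \<open>0\<^sup>i 1\<close> simulates \<open>a i\<close> on the states with counter \<open>0\<close>, so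
  a carefully synchronizing word of \<open>P\<close> can be simulated once all counters are \<open>0\<close>
  (\<open>synchronizing_word_up\<close>). To get there, \<open>0\<^bsup>k p\<^esup>\<close> applies \<open>s\<^sup>p\<close> to every state without
  requiring equal counters. After that all symbols are defined, so the letter \<open>1\<close>, which applies
  different symbols in different layers, is safe, and it resets every counter.
\<close>

section \<open>Runs and shortest synchronizing words\<close>

lemma run_single [simp]: "run P q [x] = delta P q x"
  by (simp add: run_def)

lemma run_append: "run P q (u @ v) = Option.bind (run P q u) (\<lambda>r. run P r v)"
proof (induction v rule: rev_induct)
  case (snoc x v)
  then show ?case
    by (simp flip: append_assoc)
qed simp

lemma delta_in_states:
  assumes "is_pfa P" "q \<in> states P" "x \<in> alphabet P" "delta P q x = Some r"
  shows "r \<in> states P"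
  using assms by (auto simp: is_pfa_def)

lemma run_in_states:
  assumes "is_pfa P" "w \<in> lists (alphabet P)" "q \<in> states P" "run P q w = Some r"
  shows "r \<in> states P"
  using assms(2,4)
proof (induction w arbitrary: r rule: rev_induct)
  case (snoc x w)
  then show ?case
    using assms(1) by (auto simp: is_pfa_def split: bind_splits)
qed (use assms(3) in auto)

lemma shortest_length_le:
  assumes "carefully_synchronizing_word P w"
  shows "shortest_length P \<le> length w"
  unfolding shortest_length_def by (rule Least_le) (use assms in blast)

lemma shortest_word_exists:
  assumes "carefully_synchronizing P"
  obtains w where "carefully_synchronizing_word P w" "length w = shortest_length P"
proof -
  have "\<exists>k w. carefully_synchronizing_word P w \<and> length w = k"
    using assms by (auto simp: carefully_synchronizing_def)
  then have "\<exists>w. carefully_synchronizing_word P w \<and> length w = shortest_length P"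
    unfolding shortest_length_def by (rule LeastI_ex)
  then show thesis
    using that by blast
qed

section \<open>Renaming states\<close>

definition rename_states :: "('q \<Rightarrow> 'r) \<Rightarrow> ('q, 'a) pfa \<Rightarrow> ('r, 'a) pfa" where
  "rename_states h P = \<lparr>states = h ` states P, alphabet = alphabet P,
     delta = (\<lambda>x a. map_option h (delta P (inv_into (states P) h x) a))\<rparr>"

lemma rename_states_simps [simp]:
  "states (rename_states h P) = h ` states P"
  "alphabet (rename_states h P) = alphabet P"
  by (simp_all add: rename_states_def)

lemma delta_rename_states:
  assumes "inj_on h (states P)" "q \<in> states P"
  shows "delta (rename_states h P) (h q) a = map_option h (delta P q a)"
  using assms by (simp add: rename_states_def)

lemma is_pfa_rename_states:
  assumes "is_pfa P" "inj_on h (states P)"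
  shows "is_pfa (rename_states h P)"
  using assms by (auto simp: is_pfa_def delta_rename_states)

lemma run_rename_states:
  assumes "is_pfa P" "inj_on h (states P)" "w \<in> lists (alphabet P)" "q \<in> states P"
  shows "run (rename_states h P) (h q) w = map_option h (run P q w)"
  using assms(3)
proof (induction w rule: rev_induct)
  case (snoc x w)
  then have IH: "run (rename_states h P) (h q) w = map_option h (run P q w)"
    and w: "w \<in> lists (alphabet P)"
    by auto
  show ?case
  proof (cases "run P q w")
    case (Some r)
    then have "r \<in> states P"
      using run_in_states assms(1,4) w by metis
    then show ?thesis
      using Some IH delta_rename_states[OF assms(2)] by simp
  qed (simp add: IH)
qed simp

lemma synchronizing_word_rename_states:
  assumes "is_pfa P" "inj_on h (states P)"
  shows "carefully_synchronizing_word (rename_states h P) w \<longleftrightarrow> carefully_synchronizing_word P w"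
proof (cases "w \<in> lists (alphabet P)")
  case True
  have run_iff: "run (rename_states h P) (h q) w = Some (h r) \<longleftrightarrow> run P q w = Some r"
    if q: "q \<in> states P" and r: "r \<in> states P" for q r
  proof (cases "run P q w")
    case (Some t)
    then have "t \<in> states P"
      using run_in_states[OF assms(1) True q] by blast
    then show ?thesis
      using run_rename_states[OF assms True q] Some inj_on_eq_iff[OF assms(2) _ r] by simp
  qed (simp add: run_rename_states[OF assms True q])
  show ?thesis
    using True by (simp add: carefully_synchronizing_word_def run_iff)
qed (simp add: carefully_synchronizing_word_def)

section \<open>The binary automaton with a symbol counter\<close>

definition counter_pfa ::
    "('q, 'a) pfa \<Rightarrow> 'a \<Rightarrow> 'q set \<Rightarrow> (nat \<Rightarrow> 'a) \<Rightarrow> nat \<Rightarrow> ('q \<times> nat, nat) pfa" where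
  "counter_pfa P s Q' a k = \<lparr>
     states = Q' \<times> {0} \<union> (states P - Q') \<times> {..<k},
     alphabet = {0, 1},
     delta = (\<lambda>(q, i) x.
       if x = 0
       then if q \<in> Q' then Some (q, 0)
            else if Suc i < k then Some (q, Suc i)
            else map_option (\<lambda>r. (r, 0)) (delta P q s)
       else map_option (\<lambda>r. (r, 0)) (delta P q (a i)))\<rparr>"

text \<open>
  The enumeration \<open>a\<close> may repeat symbols and may contain \<open>s\<close>. So \<open>k = 1\<close> with \<open>a 0 = s\<close> covers
  the one-letter alphabet.
\<close>

locale counter_construction =
  fixes P :: "('q, 'a) pfa" and s :: 'a and Q' :: "'q set" and a :: "nat \<Rightarrow> 'a" and k :: nat
  assumes pfa: "is_pfa P"
    and k_pos: "0 < k"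
    and alphabet_eq: "alphabet P = insert s (a ` {..<k})"
    and Q'_subset: "Q' \<subseteq> states P"
    and fixed: "q \<in> Q' \<Longrightarrow> delta P q s = Some q"
    and agree: "q \<in> Q' \<Longrightarrow> i < k \<Longrightarrow> j < k \<Longrightarrow> delta P q (a i) = delta P q (a j)"
begin

abbreviation R :: "('q \<times> nat, nat) pfa" where
  "R \<equiv> counter_pfa P s Q' a k"

text \<open>
  The state that represents \<open>q\<close> under counter value \<open>i\<close>. Through \<open>place\<close> the two letters obey the
  same transition rules inside and outside \<open>Q'\<close>.
\<close>

definition place :: "nat \<Rightarrow> 'q \<Rightarrow> 'q \<times> nat" where
  "place i q = (if q \<in> Q' then (q, 0) else (q, i))"

lemma fst_place [simp]: "fst (place i q) = q"
  by (simp add: place_def)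

lemma alphabet_R: "alphabet R = {0, 1}"
  by (simp add: counter_pfa_def)

lemma states_R: "states R = {place i q | i q. i < k \<and> q \<in> states P}"
  using Q'_subset k_pos by (auto simp: counter_pfa_def place_def)

lemma place_in_states: "i < k \<Longrightarrow> q \<in> states P \<Longrightarrow> place i q \<in> states R"
  by (auto simp: states_R)

lemma delta_increment: "Suc i < k \<Longrightarrow> delta R (place i q) 0 = Some (place (Suc i) q)"
  by (simp add: counter_pfa_def place_def)

lemma delta_overflow: "Suc i = k \<Longrightarrow> delta R (place i q) 0 = map_option (place 0) (delta P q s)"
  by (auto simp: counter_pfa_def place_def fixed intro!: option.map_cong)

lemma delta_apply: "i < k \<Longrightarrow> delta R (place i q) 1 = map_option (place 0) (delta P q (a i))"
  using agree[of q 0 i] k_pos by (auto simp: counter_pfa_def place_def intro!: option.map_cong)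

lemma is_pfa_R: "is_pfa R"
proof -
  have fin: "finite (states R)"
    using pfa Q'_subset by (auto simp: counter_pfa_def is_pfa_def intro: finite_subset)
  have closed: "place 0 r \<in> states R"
    if "q \<in> states P" "x \<in> alphabet P" "delta P q x = Some r" for q x r
    using delta_in_states[OF pfa that] place_in_states[OF k_pos] by blast
  have "y \<in> states R" if x: "x \<in> states R" "l \<in> alphabet R" "delta R x l = Some y" for x l y
  proof -
    obtain i q where i: "i < k" "q \<in> states P" "x = place i q"
      using x(1) by (auto simp: states_R)
    consider "l = 0" "Suc i < k" | "l = 0" "Suc i = k" | "l = 1"
      using x(2) i(1) by (force simp: alphabet_R)
    then show ?thesis
    proof cases
      case 1
      then show ?thesis
        using x(3) i delta_increment by (auto intro: place_in_states)
    next
      case 2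
      then show ?thesis
        using x(3) i delta_overflow[OF 2(2)] closed[of q s] by (auto simp: alphabet_eq)
    next
      case 3
      then show ?thesis
        using x(3) i delta_apply[OF i(1)] closed[of q "a i"] by (auto simp: alphabet_eq)
    qed
  qed
  then show ?thesis
    using fin by (auto simp: is_pfa_def alphabet_R)
qed

lemma card_states_R: "card (states R) = card (states P) + (card (states P) - card Q') * (k - 1)"
proof -
  have fin: "finite (states P)" "finite Q'"
    using pfa Q'_subset finite_subset by (auto simp: is_pfa_def)
  have "card (states R) = card Q' + card (states P - Q') * k"
    using fin by (simp add: counter_pfa_def, subst card_Un_disjoint)
      (auto simp: card_cartesian_product)
  moreover have "card (states P - Q') = card (states P) - card Q'"
    using fin Q'_subset by (simp add: card_Diff_subset)
  moreover have "card Q' \<le> card (states P)"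
    using fin Q'_subset by (simp add: card_mono)
  ultimately show ?thesis
    using k_pos by (cases k) auto
qed

text \<open>
  A single word \<open>u\<close> and a single counter \<open>i\<close> serve all start states at once, since the evolution
  of the counter depends only on the letters read. Each letter of \<open>w\<close> contributes at most one
  symbol to \<open>u\<close>.
\<close>

lemma run_R_simulated:
  assumes "w \<in> lists {0, 1}"
  shows "\<exists>u i. u \<in> lists (alphabet P) \<and> i < k \<and> length u \<le> length w \<and>
           (\<forall>q. run R (place 0 q) w = map_option (place i) (run P q u))"
  using assms
proof (induction w rule: rev_induct)
  case Nil
  then show ?case
    using k_pos by (auto intro!: exI[of _ "[]"])
next
  case (snoc x w)
  then obtain u i where u: "u \<in> lists (alphabet P)" "i < k" "length u \<le> length w"
    and run: "\<And>q. run R (place 0 q) w = map_option (place i) (run P q u)"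
    by auto
  consider "x = 0" "Suc i < k" | "x = 0" "Suc i = k" | "x = 1"
    using snoc.prems u(2) by force
  then show ?case
  proof cases
    case 1
    have "run R (place 0 q) (w @ [x]) = map_option (place (Suc i)) (run P q u)" for q
      using 1 run[of q] delta_increment by (cases "run P q u") auto
    then show ?thesis
      using u 1 by (intro exI[of _ u] exI[of _ "Suc i"]) auto
  next
    case 2
    have "run R (place 0 q) (w @ [x]) = map_option (place 0) (run P q (u @ [s]))" for q
      using 2 run[of q] delta_overflow by (cases "run P q u") auto
    then show ?thesis
      using u k_pos by (intro exI[of _ "u @ [s]"] exI[of _ 0]) (auto simp: alphabet_eq)
  next
    case 3
    have "run R (place 0 q) (w @ [x]) = map_option (place 0) (run P q (u @ [a i]))" for q
      using 3 run[of q] delta_apply[OF u(2)] by (cases "run P q u") auto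
    then show ?thesis
      using u k_pos by (intro exI[of _ "u @ [a i]"] exI[of _ 0]) (auto simp: alphabet_eq)
  qed
qed

lemma synchronizing_word_down:
  assumes "carefully_synchronizing_word R w"
  obtains u where "carefully_synchronizing_word P u" "length u \<le> length w"
proof -
  obtain x where x: "x \<in> states R" "\<And>y. y \<in> states R \<Longrightarrow> run R y w = Some x"
    using assms by (auto simp: carefully_synchronizing_word_def)
  have "w \<in> lists {0, 1}"
    using assms by (simp add: carefully_synchronizing_word_def alphabet_R)
  then obtain u i where u: "u \<in> lists (alphabet P)" "length u \<le> length w"
    and run: "\<And>q. run R (place 0 q) w = map_option (place i) (run P q u)"
    using run_R_simulated by blast
  have "run P q u = Some (fst x)" if "q \<in> states P" for q
  proof -
    have "map_option (place i) (run P q u) = Some x"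
      using run[of q] x(2)[OF place_in_states[OF k_pos that]] by simp
    then show ?thesis
      by auto
  qed
  moreover have "fst x \<in> states P"
    using x(1) by (auto simp: states_R)
  ultimately show thesis
    using that u unfolding carefully_synchronizing_word_def by blast
qed

lemma run_increments:
  "i + j < k \<Longrightarrow> run R (place i q) (replicate j 0) = Some (place (i + j) q)"
proof (induction j)
  case (Suc j)
  then show ?case
    using delta_increment[of "i + j" q] by (simp add: replicate_append_same[symmetric])
qed simp

text \<open>
  A full turn of the counter passes through exactly one overflow, whatever its initial value, and
  brings it back to this value.
\<close>

lemma run_full_turn:
  assumes "i < k"
  shows "run R (place i q) (replicate k 0) = map_option (place i) (delta P q s)"
proof -
  have k: "replicate k (0::nat) = (replicate (k - Suc i) 0 @ [0]) @ replicate i 0"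
    using assms by (simp add: replicate_append_same flip: replicate_add replicate_Suc)
  have "run R (place i q) (replicate (k - Suc i) 0 @ [0]) = map_option (place 0) (delta P q s)"
    using assms run_increments[of i "k - Suc i" q] delta_overflow[of "k - 1" q] by simp
  then show ?thesis
    unfolding k run_append using assms run_increments[of 0 i] by (cases "delta P q s") auto
qed

lemma run_full_turns:
  assumes "i < k"
  shows "run R (place i q) (replicate (p * k) 0) = map_option (place i) (run P q (replicate p s))"
proof (induction p)
  case (Suc p)
  have "replicate (Suc p * k) (0::nat) = replicate (p * k) 0 @ replicate k 0"
    by (simp add: add.commute flip: replicate_add)
  moreover have "replicate (Suc p) s = replicate p s @ [s]"
    by (simp add: replicate_append_same)
  ultimately show ?case
    using Suc run_full_turn[OF assms]
    by (simp only: run_append run_snoc) (cases "run P q (replicate p s)"; simp)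
qed simp

lemma run_P_simulated:
  assumes "u \<in> lists (alphabet P)"
  shows "\<exists>w \<in> lists {0, 1}. \<forall>q. run R (place 0 q) w = map_option (place 0) (run P q u)"
  using assms
proof (induction u rule: rev_induct)
  case Nil
  show ?case
    by (rule bexI[of _ "[]"]) auto
next
  case (snoc x u)
  then obtain w where w: "w \<in> lists {0, 1}"
    and run: "\<And>q. run R (place 0 q) w = map_option (place 0) (run P q u)"
    by auto
  have "\<exists>v \<in> lists {0, 1}. \<forall>q. run R (place 0 q) v = map_option (place 0) (delta P q x)"
  proof (cases "x = s")
    case True
    then show ?thesis
      using run_full_turn[OF k_pos] by (intro bexI[of _ "replicate k 0"]) auto
  next
    case False
    then obtain i where i: "i < k" "x = a i"
      using snoc.prems by (auto simp: alphabet_eq)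
    then show ?thesis
      using run_increments[of 0 i] delta_apply[of i]
      by (intro bexI[of _ "replicate i 0 @ [1]"]) auto
  qed
  then obtain v where v: "v \<in> lists {0, 1}"
    and run': "\<And>q. run R (place 0 q) v = map_option (place 0) (delta P q x)"
    by blast
  have "run R (place 0 q) (w @ v) = map_option (place 0) (run P q (u @ [x]))" for q
    using run[of q] run' by (cases "run P q u") (auto simp: run_append)
  then show ?case
    using w v by (intro bexI[of _ "w @ v"]) auto
qed

lemma synchronizing_word_up:
  assumes sync: "carefully_synchronizing_word P u"
    and complete: "complete_symbol P s"
    and defined: "\<forall>x\<in>alphabet P. defined_on P x (image_word P (replicate p s))"
  shows "carefully_synchronizing R"
proof -
  obtain t where t: "t \<in> states P" "\<And>q. q \<in> states P \<Longrightarrow> run P q u = Some t"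
    and u: "u \<in> lists (alphabet P)"
    using sync by (auto simp: carefully_synchronizing_word_def)
  obtain w where w: "w \<in> lists {0, 1}"
    and run_w: "\<And>q. run R (place 0 q) w = map_option (place 0) (run P q u)"
    using run_P_simulated[OF u] by blast
  have s_pow: "\<exists>r\<in>states P. run P q (replicate j s) = Some r" if "q \<in> states P" for q j
  proof (induction j)
    case (Suc j)
    then obtain r where r: "r \<in> states P" "run P q (replicate j s) = Some r"
      by (elim bexE)
    have "delta P r s \<noteq> None"
      using complete r(1) by (simp add: complete_symbol_def defined_on_def)
    then obtain r' where r': "delta P r s = Some r'"
      by (cases "delta P r s") simp_all
    have "r' \<in> states P"
      using delta_in_states[OF pfa r(1) _ r'] by (simp add: alphabet_eq)
    moreover have "run P q (replicate (Suc j) s) = Some r'"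
      using r(2) r' by (simp add: replicate_append_same[symmetric])
    ultimately show ?case
      by blast
  qed (use that in simp)
  let ?v = "replicate (p * k) 0 @ [1]"
  \<comment> \<open>\<open>?v\<close> is defined everywhere and brings every state to counter \<open>0\<close>.\<close>
  have reset: "\<exists>r\<in>states P. run R y ?v = Some (place 0 r)" if y: "y \<in> states R" for y
  proof -
    obtain i q where i: "i < k" "q \<in> states P" "y = place i q"
      using y by (auto simp: states_R)
    obtain r where r: "r \<in> states P" "run P q (replicate p s) = Some r"
      using s_pow i(2) by blast
    have ai: "a i \<in> alphabet P"
      using i(1) by (simp add: alphabet_eq)
    have "r \<in> image_word P (replicate p s)"
      using r i(2) by (auto simp: image_word_def)
    then obtain r' where r': "delta P r (a i) = Some r'"
      using defined ai by (auto simp: defined_on_def)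
    have "run R y ?v = Some (place 0 r')"
      using i r r' run_full_turns[OF i(1)] delta_apply[OF i(1)] by simp
    moreover have "r' \<in> states P"
      using delta_in_states[OF pfa r(1) ai r'] .
    ultimately show ?thesis
      by blast
  qed
  have "run R y (?v @ w) = Some (place 0 t)" if y: "y \<in> states R" for y
  proof -
    obtain r where "r \<in> states P" "run R y ?v = Some (place 0 r)"
      using reset[OF y] by blast
    then show ?thesis
      using run_w t(2) by (simp only: run_append) simp
  qed
  moreover have "?v @ w \<in> lists (alphabet R)"
    using w by (auto simp: alphabet_R)
  ultimately show ?thesis
    using place_in_states[OF k_pos t(1)]
    unfolding carefully_synchronizing_def carefully_synchronizing_word_def by blast
qed

end

section \<open>The binary bound\<close>

text \<open>
  If \<open>s\<close> is the only symbol, it is listed itself, because the counter needs at least one value.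
  Then \<open>k - 1 = card A - 2\<close> still holds, by truncated subtraction.
\<close>

lemma enumerate_other_symbols:
  assumes "finite A" "s \<in> A"
  obtains a :: "nat \<Rightarrow> 'a" and k :: nat
  where "0 < k" "k - 1 = card A - 2" "A = insert s (a ` {..<k})"
    "k = 1 \<or> (\<forall>i<k. a i \<in> A - {s})"
proof (cases "A = {s}")
  case True
  then show thesis
    using that[of 1 "\<lambda>_. s"] by auto
next
  case False
  have fin: "finite (A - {s})"
    using assms by simp
  obtain a where a: "bij_betw a {0..<card (A - {s})} (A - {s})"
    using ex_bij_betw_nat_finite[OF fin] by blast
  have img: "a ` {..<card (A - {s})} = A - {s}"
    using a by (simp add: bij_betw_def atLeast0LessThan)
  show thesis
  proof (rule that[of "card (A - {s})" a])
    have "A - {s} \<noteq> {}"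
      using False assms by blast
    then show "0 < card (A - {s})"
      using fin by (simp only: card_gt_0_iff) simp
    show "card (A - {s}) - 1 = card A - 2"
      using assms by (simp add: card_Diff_singleton)
  qed (use img assms in auto)
qed

theorem theorem8:
  fixes P :: "('q, 'a) pfa" and s :: 'a and Q' :: "'q set" and n m n' f :: nat
  assumes "is_pfa P"
    and "carefully_synchronizing P"
    and "card (states P) = n"
    and "card (alphabet P) = m"
    and "shortest_length P = f"
    and "s \<in> alphabet P"
    and "Q' \<subseteq> states P"
    and "complete_symbol P s"
    and "\<exists>p::nat. \<forall>a\<in>alphabet P. defined_on P a (image_word P (replicate p s))"
    and "\<forall>q\<in>Q'. delta P q s = Some q"
    and "\<forall>q\<in>Q'. \<forall>a\<in>alphabet P - {s}. \<forall>b\<in>alphabet P - {s}. delta P q a = delta P q b"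
    and "n' = n - card Q'"
  shows "\<exists>R :: (nat, nat) pfa. is_pfa R \<and> carefully_synchronizing R \<and>
           card (states R) = n + n' * (m - 2) \<and> card (alphabet R) = 2 \<and>
           shortest_length R \<ge> f"
proof -
  have "finite (alphabet P)"
    using assms(1) by (simp add: is_pfa_def)
  then obtain a k where k: "0 < k" "k - 1 = m - 2" "alphabet P = insert s (a ` {..<k})"
    "k = 1 \<or> (\<forall>i<k. a i \<in> alphabet P - {s})"
    using enumerate_other_symbols[OF _ assms(6)] assms(4) by metis
  have agree: "delta P q (a i) = delta P q (a j)" if "q \<in> Q'" "i < k" "j < k" for q i j
    using k(4)
  proof
    assume "\<forall>i<k. a i \<in> alphabet P - {s}"
    then show ?thesis
      using assms(11) that by blast
  qed (use that in simp)
  interpret counter_construction P s Q' a k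
  proof unfold_locales
    show "delta P q s = Some q" if "q \<in> Q'" for q
      using assms(10) that by blast
  qed (fact assms(1) k(1) k(3) assms(7) agree)+
  obtain p where "\<forall>x\<in>alphabet P. defined_on P x (image_word P (replicate p s))"
    using assms(9) by blast
  then have sync: "carefully_synchronizing R"
    using assms(2,8) synchronizing_word_up by (auto simp: carefully_synchronizing_def)
  have fin: "finite (states R)"
    using is_pfa_R by (simp add: is_pfa_def)
  then obtain h :: "'q \<times> nat \<Rightarrow> nat" where h: "inj_on h (states R)"
    using finite_imp_inj_to_nat_seg by blast
  let ?N = "rename_states h R"
  note words = synchronizing_word_rename_states[OF is_pfa_R h]
  have sync_N: "carefully_synchronizing ?N"
    using sync by (simp add: carefully_synchronizing_def words)
  then obtain w where w: "carefully_synchronizing_word R w" "length w = shortest_length ?N"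
    using shortest_word_exists words by metis
  obtain u where u: "carefully_synchronizing_word P u" "length u \<le> length w"
    using synchronizing_word_down[OF w(1)] .
  have "f \<le> shortest_length ?N"
    using shortest_length_le[OF u(1)] u(2) w(2) assms(5) by simp
  moreover have "card (states ?N) = n + n' * (m - 2)"
    using card_states_R k(2) assms(3,12) by (simp add: card_image[OF h])
  moreover have "card (alphabet ?N) = 2"
    by (simp add: alphabet_R)
  ultimately show ?thesis
    using is_pfa_rename_states[OF is_pfa_R h] sync_N by blast
qed

end
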